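(* Let $\mathbf{G}$ be a Carnot group with first layer $V_1$, let $c:\mathbf{G}\times V_1\to\mathbb{R}$, and let $T:\mathbf{G}\to\mathcal{P}(V_1)$ be a $c$ H--cyclically monotone map. Then, for every $g_0\in\mathrm{int}(\mathrm{dom}(T))$, there exists a $c$ H--convex function $f_{g_0}:\mathcal{H}(g_0,\mathrm{dom}(T))\to\mathbb{R}$ such that $$T(g)\subset\partial_H^cf_{g_0}(g)\qquad\text{for every } g\in\mathcal{H}(g_0,\mathrm{dom}(T)).$$
   Context: A Carnot group $\mathbf{G}$ of step $r$ is a connected, simply connected, nilpotent Lie group whose Lie algebra $\mathfrak{g}$ of left--invariant vector fields is stratified: $\mathfrak{g}=V_1\oplus\dots\oplus V_r$ with $V_j\ne\{0\}$, $[V_1,V_j]=V_{j+1}$ for $1\le j\le r-1$, $[V_1,V_r]=0$. The map $\exp:\mathfrak{g}\to\mathbf{G}$ is a global diffeomorphism. The horizontal plane at $g\in\mathbf{G}$ is $H_g=\{gh:\ h\in\exp(V_1)\}$. For $\Omega\subset\mathbf{G}$, a proper function $u:\Omega\to(-\infty,+\infty]$ (i.e. $u\not\equiv+\infty$) is $c$ H--convex if for every $g\in\Omega$ the set $\mathcal{P}_g=\{(v,\alpha)\in V_1\times\mathbb{R}:\ c(g',v)+\alpha\le u(g')\ \forall g'\in H_g\cap\Omega\}$ is nonempty and $u(g)=\sup_{(v,\alpha)\in\mathcal{P}_g}(c(g,v)+\alpha)$. The $c$ H--subdifferential of $u$ at $g\in\Omega$ is $\partial_H^cu(g)=\{p\in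 V_1:\ u(g')\ge u(g)+c(g',p)-c(g,p)\ \forall g'\in H_g\cap\Omega\}$. (For $f_{g_0}$, $\Omega=\mathcal{H}(g_0,\mathrm{dom}(T))$.) $\mathcal{P}(V_1)$ is the power set of $V_1$. For a multivalued map $T:\mathbf{G}\to\mathcal{P}(V_1)$, $\mathrm{dom}(T)=\{g\in\mathbf{G}:T(g)\neq\emptyset\}$ and $\mathrm{graph}(T)=\{(g,v)\in\mathbf{G}\times V_1:\ g\in\mathrm{dom}(T),\ v\in T(g)\}$. A finite sequence $\{g_i\}_{i=0}^n$, $n>0$, of points of $\mathbf{G}$ is an H--sequence if $g_{i+1}\in H_{g_i}$ for $i=0,\dots,n-1$; it is closed if moreover $g_n\in H_{g_0}$, in which case one sets $g_{n+1}=g_0$. For $A\subset\mathbf{G}$ and $g_0\in A$, $\mathcal{H}(g_0,A)$ is the set of points $g$ for which there exists an H--sequence $\{g_i\}_{i=0}^n$ starting at $g_0$ with $g_n=g$ and $g_i\in A$ for every $i=1,\dots,n$. A set $\mathcal{R}\subset\mathbf{G}\times V_1$ is $c$ H--cyclically monotone if for every sequence $\{(g_i,p_i)\}_{i=0}^n\subset\mathcal{R}$ such that $\{g_i\}_{i=0}^n$ is a closed H--sequence, $\sum_{i=0}^nc(g_{i+1},p_i)\le\sum_{i=0}^nc(g_i,p_i)$. The map $T$ is $c$ H--cyclically monotone if $\mathrm{graph}(T)$ is. *)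

theory Defs
  imports
    "HOL-Analysis.Analysis"
    "HOL-Algebra.Generated_Groups"
    "HOL-Library.Function_Algebras"
begin

section \<open>Functions form a real vector space\<close>

text \<open>Gives \<^const>\<open>subspace\<close> and \<^const>\<open>span\<close> a meaning for sets of vector fields,
  which are operators on real functions.\<close>

instantiation "fun" :: (type, real_vector) real_vector
begin

definition scaleR_fun_def: "r *\<^sub>R f = (\<lambda>x. r *\<^sub>R f x)"

instance
  by standard (simp_all add: scaleR_fun_def fun_eq_iff scaleR_add_right scaleR_add_left)

end


section \<open>Smooth maps and manifolds\<close>

text \<open>Differentiability classes on open sets: \<open>f\<close> is \<open>C\<^sup>k\<^sup>+\<^sup>1\<close> iff it is differentiable and
  all its directional derivatives are \<open>C\<^sup>k\<close>.\<close>

fun Ck_on :: "nat \<Rightarrow> ('a::euclidean_space \<Rightarrow> 'b::euclidean_space) \<Rightarrow> 'a set \<Rightarrow> bool" where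
  "Ck_on 0 f S \<longleftrightarrow> continuous_on S f"
| "Ck_on (Suc k) f S \<longleftrightarrow>
     f differentiable_on S \<and> (\<forall>v. Ck_on k (\<lambda>x. frechet_derivative f (at x) v) S)"

definition smooth_on_open :: "('a::euclidean_space \<Rightarrow> 'b::euclidean_space) \<Rightarrow> 'a set \<Rightarrow> bool" where
  "smooth_on_open f S \<longleftrightarrow> open S \<and> (\<forall>k. Ck_on k f S)"

type_synonym ('g, 'e) chart = "'g set \<times> ('g \<Rightarrow> 'e)"

text \<open>The manifold is the whole type \<open>'g\<close>; its dimension is \<open>DIM('e)\<close>.  The atlas need not be
  maximal.\<close>

definition smooth_atlas :: "('g::{t2_space,second_countable_topology}, 'e::euclidean_space) chart set \<Rightarrow> bool" where
  "smooth_atlas A \<longleftrightarrow>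
     (\<Union>(U, \<phi>)\<in>A. U) = UNIV \<and>
     (\<forall>(U, \<phi>)\<in>A. open U \<and> open (\<phi> ` U) \<and> homeomorphism U (\<phi> ` U) \<phi> (inv_into U \<phi>)) \<and>
     (\<forall>(U, \<phi>)\<in>A. \<forall>(V, \<psi>)\<in>A. smooth_on_open (\<psi> \<circ> inv_into U \<phi>) (\<phi> ` (U \<inter> V)))"

definition smooth_functions :: "('g::{t2_space,second_countable_topology}, 'e::euclidean_space) chart set \<Rightarrow> ('g \<Rightarrow> real) set" where
  "smooth_functions A = {f. \<forall>(U, \<phi>)\<in>A. smooth_on_open (f \<circ> inv_into U \<phi>) (\<phi> ` U)}"


section \<open>Lie groups and left-invariant vector fields\<close>

text \<open>A Lie group: \<open>G\<close> is a group on the whole type \<open>'g\<close>, and multiplication and inversion are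
  smooth, i.e. continuous and smooth when read in charts.\<close>

definition lie_group ::
  "('g::{t2_space,second_countable_topology}) monoid \<Rightarrow> ('g, 'e::euclidean_space) chart set \<Rightarrow> bool" where
  "lie_group G A \<longleftrightarrow>
     group G \<and> carrier G = UNIV \<and> smooth_atlas A \<and>
     continuous_on UNIV (\<lambda>(x, y). x \<otimes>\<^bsub>G\<^esub> y) \<and>
     continuous_on UNIV (\<lambda>x. inv\<^bsub>G\<^esub> x) \<and>
     (\<forall>(U, \<phi>)\<in>A. \<forall>(V, \<psi>)\<in>A. \<forall>(W, \<theta>)\<in>A.
        smooth_on_open (\<lambda>(x, y). \<theta> (inv_into U \<phi> x \<otimes>\<^bsub>G\<^esub> inv_into V \<psi> y))
          {(x, y). x \<in> \<phi> ` U \<and> y \<in> \<psi> ` V \<and> inv_into U \<phi> x \<otimes>\<^bsub>G\<^esub> inv_into V \<psi> y \<in> W}) \<and>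
     (\<forall>(U, \<phi>)\<in>A. \<forall>(W, \<theta>)\<in>A.
        smooth_on_open (\<lambda>x. \<theta> (inv\<^bsub>G\<^esub> (inv_into U \<phi> x)))
          {x. x \<in> \<phi> ` U \<and> inv\<^bsub>G\<^esub> (inv_into U \<phi> x) \<in> W})"

type_synonym 'g vfield = "('g \<Rightarrow> real) \<Rightarrow> ('g \<Rightarrow> real)"

text \<open>Smooth vector fields are the derivations of the algebra of smooth functions.  Since the
  operators are total, they are normalised to \<open>0\<close> on non-smooth functions, so that equality of
  operators is equality of vector fields.\<close>

definition vector_fields :: "('g::{t2_space,second_countable_topology}, 'e::euclidean_space) chart set \<Rightarrow> 'g vfield set" where
  "vector_fields A = {X.
     (\<forall>f\<in>smooth_functions A. X f \<in> smooth_functions A) \<and>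
     (\<forall>f\<in>smooth_functions A. \<forall>h\<in>smooth_functions A. \<forall>a b.
        X (a *\<^sub>R f + b *\<^sub>R h) = a *\<^sub>R X f + b *\<^sub>R X h) \<and>
     (\<forall>f\<in>smooth_functions A. \<forall>h\<in>smooth_functions A. X (f * h) = X f * h + f * X h) \<and>
     (\<forall>f. f \<notin> smooth_functions A \<longrightarrow> X f = 0)}"

definition lie_algebra ::
  "('g::{t2_space,second_countable_topology}) monoid \<Rightarrow> ('g, 'e::euclidean_space) chart set \<Rightarrow> 'g vfield set" where
  "lie_algebra G A = {X \<in> vector_fields A.
     \<forall>g. \<forall>f\<in>smooth_functions A. X (\<lambda>x. f (g \<otimes>\<^bsub>G\<^esub> x)) = (\<lambda>x. X f (g \<otimes>\<^bsub>G\<^esub> x))}"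

definition lie_bracket :: "'g vfield \<Rightarrow> 'g vfield \<Rightarrow> 'g vfield" where
  "lie_bracket X Y = (\<lambda>f. X (Y f) - Y (X f))"

definition bracket_span :: "'g vfield set \<Rightarrow> 'g vfield set \<Rightarrow> 'g vfield set" where
  "bracket_span V W = span {lie_bracket X Y | X Y. X \<in> V \<and> Y \<in> W}"

definition one_parameter_subgroup ::
  "('g::{t2_space,second_countable_topology}) monoid \<Rightarrow> ('g, 'e::euclidean_space) chart set \<Rightarrow> 'g vfield \<Rightarrow> (real \<Rightarrow> 'g) \<Rightarrow> bool" where
  "one_parameter_subgroup G A X \<gamma> \<longleftrightarrow>
     continuous_on UNIV \<gamma> \<and>
     (\<forall>s t. \<gamma> (s + t) = \<gamma> s \<otimes>\<^bsub>G\<^esub> \<gamma> t) \<and>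
     (\<forall>f\<in>smooth_functions A. \<forall>t. ((\<lambda>s. f (\<gamma> s)) has_real_derivative X f (\<gamma> t)) (at t))"

text \<open>\<open>has_exp G A X h\<close> is the graph of the exponential map, \<open>exp X = h\<close>: every left-invariant
  field \<open>X\<close> generates exactly one one-parameter subgroup, and \<open>exp X\<close> is its value at time \<open>1\<close>.\<close>

definition has_exp ::
  "('g::{t2_space,second_countable_topology}) monoid \<Rightarrow> ('g, 'e::euclidean_space) chart set \<Rightarrow> 'g vfield \<Rightarrow> 'g \<Rightarrow> bool" where
  "has_exp G A X h \<longleftrightarrow> (\<exists>\<gamma>. one_parameter_subgroup G A X \<gamma> \<and> h = \<gamma> 1)"

definition exp_image ::
  "('g::{t2_space,second_countable_topology}) monoid \<Rightarrow> ('g, 'e::euclidean_space) chart set \<Rightarrow> 'g vfield set \<Rightarrow> 'g set" where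
  "exp_image G A V = {h. \<exists>X\<in>V. has_exp G A X h}"


section \<open>Carnot groups\<close>

fun lower_central_series :: "('g, 'b) monoid_scheme \<Rightarrow> nat \<Rightarrow> 'g set" where
  "lower_central_series G 0 = carrier G"
| "lower_central_series G (Suc n) =
     generate G {x \<otimes>\<^bsub>G\<^esub> y \<otimes>\<^bsub>G\<^esub> inv\<^bsub>G\<^esub> x \<otimes>\<^bsub>G\<^esub> inv\<^bsub>G\<^esub> y | x y.
       x \<in> carrier G \<and> y \<in> lower_central_series G n}"

definition nilpotent_group :: "('g, 'b) monoid_scheme \<Rightarrow> bool" where
  "nilpotent_group G \<longleftrightarrow> group G \<and> (\<exists>n. lower_central_series G n = {\<one>\<^bsub>G\<^esub>})"

definition internal_direct_sum :: "'a::real_vector set \<Rightarrow> nat \<Rightarrow> (nat \<Rightarrow> 'a set) \<Rightarrow> bool" where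
  "internal_direct_sum L r V \<longleftrightarrow>
     (\<forall>j\<in>{1..r}. subspace (V j)) \<and>
     L = {\<Sum>j=1..r. x j | x. \<forall>j\<in>{1..r}. x j \<in> V j} \<and>
     (\<forall>x. (\<forall>j\<in>{1..r}. x j \<in> V j) \<and> (\<Sum>j=1..r. x j) = 0 \<longrightarrow> (\<forall>j\<in>{1..r}. x j = 0))"

definition carnot_group ::
  "('g::{t2_space,second_countable_topology}) monoid \<Rightarrow> ('g, 'e::euclidean_space) chart set \<Rightarrow>
   nat \<Rightarrow> (nat \<Rightarrow> 'g vfield set) \<Rightarrow> bool" where
  "carnot_group G A r V \<longleftrightarrow>
     lie_group G A \<and>
     connected (UNIV :: 'g set) \<and> simply_connected (UNIV :: 'g set) \<and> nilpotent_group G \<and>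
     1 \<le> r \<and>
     internal_direct_sum (lie_algebra G A) r V \<and>
     (\<forall>j\<in>{1..r}. V j \<noteq> {0}) \<and>
     (\<forall>j\<in>{1..<r}. bracket_span (V 1) (V j) = V (Suc j)) \<and>
     bracket_span (V 1) (V r) = {0}"

definition horizontal_plane ::
  "('g::{t2_space,second_countable_topology}) monoid \<Rightarrow> ('g, 'e::euclidean_space) chart set \<Rightarrow>
   'g vfield set \<Rightarrow> 'g \<Rightarrow> 'g set" where
  "horizontal_plane G A V1 g = {g \<otimes>\<^bsub>G\<^esub> h | h. h \<in> exp_image G A V1}"


section \<open>Horizontal $c$-convexity and cyclic monotonicity\<close>

text \<open>In this section \<open>H\<close> assigns to each point its horizontal plane, and \<open>V1\<close> is the first layer.
  A cost \<open>c\<close> on \<open>G \<times> V1\<close> is a total function; only its values at second arguments in \<open>V1\<close>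
  are ever used.  Likewise, a function on \<open>\<Omega>\<close> is a total function of which only the values on
  \<open>\<Omega>\<close> are used.\<close>

definition cH_supports ::
  "('g \<Rightarrow> 'g set) \<Rightarrow> 'v set \<Rightarrow> ('g \<Rightarrow> 'v \<Rightarrow> real) \<Rightarrow> 'g set \<Rightarrow> ('g \<Rightarrow> ereal) \<Rightarrow> 'g \<Rightarrow> ('v \<times> real) set" where
  "cH_supports H V1 c \<Omega> u g =
     {(v, \<alpha>). v \<in> V1 \<and> (\<forall>g'\<in>H g \<inter> \<Omega>. ereal (c g' v + \<alpha>) \<le> u g')}"

definition proper_on :: "'g set \<Rightarrow> ('g \<Rightarrow> ereal) \<Rightarrow> bool" where
  "proper_on \<Omega> u \<longleftrightarrow> (\<forall>g\<in>\<Omega>. u g \<noteq> -\<infinity>) \<and> (\<exists>g\<in>\<Omega>. u g \<noteq> \<infinity>)"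

definition cH_convex_on ::
  "('g \<Rightarrow> 'g set) \<Rightarrow> 'v set \<Rightarrow> ('g \<Rightarrow> 'v \<Rightarrow> real) \<Rightarrow> 'g set \<Rightarrow> ('g \<Rightarrow> ereal) \<Rightarrow> bool" where
  "cH_convex_on H V1 c \<Omega> u \<longleftrightarrow>
     proper_on \<Omega> u \<and>
     (\<forall>g\<in>\<Omega>. cH_supports H V1 c \<Omega> u g \<noteq> {} \<and>
       u g = (SUP (v, \<alpha>)\<in>cH_supports H V1 c \<Omega> u g. ereal (c g v + \<alpha>)))"

definition cH_subdifferential ::
  "('g \<Rightarrow> 'g set) \<Rightarrow> 'v set \<Rightarrow> ('g \<Rightarrow> 'v \<Rightarrow> real) \<Rightarrow> 'g set \<Rightarrow> ('g \<Rightarrow> ereal) \<Rightarrow> 'g \<Rightarrow> 'v set" where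
  "cH_subdifferential H V1 c \<Omega> u g =
     {p \<in> V1. \<forall>g'\<in>H g \<inter> \<Omega>. u g' \<ge> u g + ereal (c g' p - c g p)}"

definition mv_dom :: "('g \<Rightarrow> 'v set) \<Rightarrow> 'g set" where
  "mv_dom T = {g. T g \<noteq> {}}"

definition mv_graph :: "('g \<Rightarrow> 'v set) \<Rightarrow> ('g \<times> 'v) set" where
  "mv_graph T = {(g, v). g \<in> mv_dom T \<and> v \<in> T g}"

text \<open>The finite sequence is \<open>g 0, \<dots>, g n\<close>; values of \<open>g\<close> beyond \<open>n\<close> are irrelevant.\<close>

definition H_sequence :: "('g \<Rightarrow> 'g set) \<Rightarrow> nat \<Rightarrow> (nat \<Rightarrow> 'g) \<Rightarrow> bool" where
  "H_sequence H n g \<longleftrightarrow> 0 < n \<and> (\<forall>i<n. g (Suc i) \<in> H (g i))"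

definition closed_H_sequence :: "('g \<Rightarrow> 'g set) \<Rightarrow> nat \<Rightarrow> (nat \<Rightarrow> 'g) \<Rightarrow> bool" where
  "closed_H_sequence H n g \<longleftrightarrow> H_sequence H n g \<and> g n \<in> H (g 0)"

definition H_reachable :: "('g \<Rightarrow> 'g set) \<Rightarrow> 'g \<Rightarrow> 'g set \<Rightarrow> 'g set" where
  "H_reachable H g0 S =
     {x. \<exists>n g. H_sequence H n g \<and> g 0 = g0 \<and> g n = x \<and> (\<forall>i\<in>{1..n}. g i \<in> S)}"

text \<open>The conditional implements the convention \<open>g\<^bsub>n+1\<^esub> = g\<^sub>0\<close> for closed sequences.\<close>

definition cH_cyclically_monotone ::
  "('g \<Rightarrow> 'g set) \<Rightarrow> ('g \<Rightarrow> 'v \<Rightarrow> real) \<Rightarrow> ('g \<times> 'v) set \<Rightarrow> bool" where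
  "cH_cyclically_monotone H c R \<longleftrightarrow>
     (\<forall>n g p. (\<forall>i\<le>n. (g i, p i) \<in> R) \<and> closed_H_sequence H n g \<longrightarrow>
       (\<Sum>i\<le>n. c (if i = n then g 0 else g (Suc i)) (p i)) \<le> (\<Sum>i\<le>n. c (g i) (p i)))"

definition cH_cyclically_monotone_map ::
  "('g \<Rightarrow> 'g set) \<Rightarrow> ('g \<Rightarrow> 'v \<Rightarrow> real) \<Rightarrow> ('g \<Rightarrow> 'v set) \<Rightarrow> bool" where
  "cH_cyclically_monotone_map H c T \<longleftrightarrow> cH_cyclically_monotone H c (mv_graph T)"

end

theory Submission
  imports Defs
begin

text \<open>The potential is Rockafellar's: \<open>f x\<close> is the supremum, over all horizontal chains
  \<open>g\<^sub>0, \<dots>, g\<^sub>n, x\<close> with \<open>p\<^sub>i \<in> T g\<^sub>i\<close>, of the total gain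
  \<open>\<Sum>i. c g\<^sub>i\<^sub>+\<^sub>1 p\<^sub>i - c g\<^sub>i p\<^sub>i\<close>, where \<open>g\<^sub>n\<^sub>+\<^sub>1 = x\<close>.
  Prolonging a chain that ends at \<open>g\<close> by one more step, from \<open>g\<close> to \<open>g'\<close> with a chosen
  \<open>p \<in> T g\<close>, gives \<open>f g' \<ge> f g + c g' p - c g p\<close>, so \<open>p\<close> is a subgradient. Convexity follows
  from this: the support that \<open>p\<close> defines is attained at \<open>g\<close>.

  What needs an argument is that \<open>f\<close> is real-valued. A point reachable from \<open>g\<^sub>0\<close>
  within the domain of \<open>T\<close> is the end of some chain, so the supremum is over a nonempty set. To
  bound it, walk back from \<open>x\<close> to \<open>g\<^sub>0\<close> along a fixed path in the domain:
  this completes every chain ending at \<open>x\<close> to a closed one, at a cost that depends only on the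
  path, and closed chains have gain at most \<open>0\<close> by cyclic monotonicity.

  Walking back needs \<open>H\<close> to be symmetric, and standing still, which makes \<open>g\<^sub>0\<close>
  reachable from itself, needs \<open>g \<in> H g\<close>. For horizontal planes these two properties
  express that \<open>exp (V 1)\<close> contains the identity and is closed under inversion, because \<open>V 1\<close> is a linear subspace.\<close>

section \<open>Gains of horizontal chains\<close>

text \<open>The final point \<open>x\<close> of a chain is the argument of the potential; elements of \<open>T\<close> are chosen
  at the points before it. Generating the gains step by step makes prolonging a chain an
  introduction rule, so that sums over indexed sequences occur only in the link with cyclic monotonicity.\<close>

inductive chain_gain ::
  "('g \<Rightarrow> 'g set) \<Rightarrow> ('g \<Rightarrow> 'v \<Rightarrow> real) \<Rightarrow> ('g \<Rightarrow> 'v set) \<Rightarrow> 'g \<Rightarrow> 'g \<Rightarrow> real \<Rightarrow> bool"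
  for H c T g0 where
  start: "p \<in> T g0 \<Longrightarrow> x \<in> H g0 \<Longrightarrow> chain_gain H c T g0 x (c x p - c g0 p)"
| step: "chain_gain H c T g0 y s \<Longrightarrow> p \<in> T y \<Longrightarrow> x \<in> H y \<Longrightarrow>
    chain_gain H c T g0 x (s + (c x p - c y p))"

lemma chain_gain_sequence:
  assumes "chain_gain H c T g0 x s"
  shows "\<exists>n g p. g 0 = g0 \<and> (\<forall>i\<le>n. p i \<in> T (g i)) \<and> (\<forall>i<n. g (Suc i) \<in> H (g i)) \<and>
    g (Suc n) = x \<and> x \<in> H (g n) \<and> s = (\<Sum>i\<le>n. c (g (Suc i)) (p i) - c (g i) (p i))"
  using assms
proof induction
  case (start p x)
  then show ?case
    by (intro exI[of _ 0] exI[of _ "\<lambda>i. if i = 0 then g0 else x"] exI[of _ "\<lambda>_. p"]) simp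
next
  case (step y s q x)
  then obtain n g p where *: "g 0 = g0" "\<forall>i\<le>n. p i \<in> T (g i)" "\<forall>i<n. g (Suc i) \<in> H (g i)"
    "g (Suc n) = y" "y \<in> H (g n)" "s = (\<Sum>i\<le>n. c (g (Suc i)) (p i) - c (g i) (p i))"
    by blast
  let ?g = "g(Suc (Suc n) := x)" and ?p = "p(Suc n := q)"
  have "(\<Sum>i\<le>n. c (?g (Suc i)) (?p i) - c (?g i) (?p i)) = s"
    unfolding *(6) by (rule sum.cong) auto
  with * step show ?case
    by (intro exI[of _ "Suc n"] exI[of _ ?g] exI[of _ ?p]) (auto simp: le_Suc_eq less_Suc_eq)
qed

text \<open>Cyclic monotonicity speaks of cycles with at least two indices. A chain with a single step
  from \<open>g0\<close> to itself is not among them, but its gain vanishes.\<close>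

lemma closed_chain_gain_nonpos:
  assumes mono: "cH_cyclically_monotone_map H c T"
    and sym: "\<forall>x y. y \<in> H x \<longrightarrow> x \<in> H y"
    and gain: "chain_gain H c T g0 g0 s"
  shows "s \<le> 0"
proof -
  obtain n g p where *: "g 0 = g0" "\<forall>i\<le>n. p i \<in> T (g i)" "\<forall>i<n. g (Suc i) \<in> H (g i)"
    "g (Suc n) = g0" "g0 \<in> H (g n)" "s = (\<Sum>i\<le>n. c (g (Suc i)) (p i) - c (g i) (p i))"
    using chain_gain_sequence[OF gain] by blast
  show ?thesis
  proof (cases "n = 0")
    case True
    with * show ?thesis by simp
  next
    case False
    have graph: "\<forall>i\<le>n. (g i, p i) \<in> mv_graph T"
      using *(2) by (auto simp: mv_graph_def mv_dom_def)
    have closed: "closed_H_sequence H n g"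
      using False *(1,3) sym[rule_format, OF *(5)] unfolding closed_H_sequence_def H_sequence_def by simp
    have "(\<Sum>i\<le>n. c (g (Suc i)) (p i)) = (\<Sum>i\<le>n. c (if i = n then g 0 else g (Suc i)) (p i))"
      using *(1,4) by (intro sum.cong) auto
    also have "\<dots> \<le> (\<Sum>i\<le>n. c (g i) (p i))"
      using mono graph closed
      unfolding cH_cyclically_monotone_map_def cH_cyclically_monotone_def by blast
    finally show ?thesis
      using *(6) by (simp add: sum_subtractf)
  qed
qed

lemma H_reachable_induct [consumes 1, case_names base step]:
  assumes "x \<in> H_reachable H g0 S" and "P g0"
    and step: "\<And>y x. P y \<Longrightarrow> x \<in> H y \<Longrightarrow> x \<in> S \<Longrightarrow> P x"
  shows "P x"
proof -
  obtain n g where g: "\<forall>i<n. g (Suc i) \<in> H (g i)" "g 0 = g0" "g n = x" "\<forall>i\<in>{1..n}. g i \<in> S"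
    using assms(1) unfolding H_reachable_def H_sequence_def by blast
  have "P (g i)" if "i \<le> n" for i
    using that
  proof (induction i)
    case 0
    then show ?case using assms(2) g(2) by simp
  next
    case (Suc i)
    with g(1,4) show ?case by (intro step[of "g i" "g (Suc i)"]) auto
  qed
  with g(3) show ?thesis by blast
qed

lemma H_reachable_subset: "H_reachable H g0 S \<subseteq> S"
  unfolding H_reachable_def H_sequence_def by force

lemma ex_chain_gain:
  assumes "x \<in> H_reachable H g0 (mv_dom T)" and refl: "\<And>x. x \<in> H x" and "g0 \<in> mv_dom T"
  shows "\<exists>s. chain_gain H c T g0 x s"
proof -
  have "x \<in> mv_dom T \<and> (\<exists>s. chain_gain H c T g0 x s)"
    using assms(1)
  proof (induction rule: H_reachable_induct)
    case base
    show ?case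
      using assms(3) chain_gain.start[of _ T g0 g0 H c] refl unfolding mv_dom_def by blast
  next
    case (step y x)
    then show ?case
      using chain_gain.step[of H c T g0 y _ _ x] unfolding mv_dom_def by blast
  qed
  then show ?thesis ..
qed

text \<open>The bound is carried forward along a path from \<open>g0\<close>: since \<open>H\<close> is symmetric, a chain ending
  at \<open>x\<close> can be prolonged by a step back to the preceding point \<open>y\<close> of the path, where a bound is
  already known.\<close>

lemma bdd_above_chain_gain:
  assumes "x \<in> H_reachable H g0 (mv_dom T)"
    and mono: "cH_cyclically_monotone_map H c T"
    and sym: "\<forall>x y. y \<in> H x \<longrightarrow> x \<in> H y"
  shows "bdd_above {s. chain_gain H c T g0 x s}"
  using assms(1)
proof (induction rule: H_reachable_induct)
  case base
  show ?case
    by (rule bdd_aboveI[of _ 0]) (use closed_chain_gain_nonpos[OF mono sym] in blast)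
next
  case (step y x)
  then obtain K where K: "\<And>s. chain_gain H c T g0 y s \<Longrightarrow> s \<le> K"
    unfolding bdd_above_def by auto
  obtain p where p: "p \<in> T x"
    using step.hyps unfolding mv_dom_def by blast
  have "s \<le> K - (c y p - c x p)" if "chain_gain H c T g0 x s" for s
    using K[OF chain_gain.step[OF that p sym[rule_format, OF step.hyps(1)]]] by simp
  then show ?case
    by (intro bdd_aboveI[of _ "K - (c y p - c x p)"]) blast
qed

section \<open>The potential\<close>

text \<open>Where every point of \<open>\<Omega>\<close> has a subgradient, convexity costs nothing: a subgradient \<open>p\<close> at
  \<open>g\<close> yields the support \<open>c g' p + (f g - c g p)\<close>, exact at \<open>g\<close>, while reflexivity of \<open>H\<close> keeps
  every other support at \<open>g\<close> below \<open>f g\<close>.\<close>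

lemma cH_convex_on_if_subdifferentiable:
  assumes refl: "\<And>x. x \<in> H x" and "\<Omega> \<noteq> {}"
    and sub: "\<And>g. g \<in> \<Omega> \<Longrightarrow> cH_subdifferential H V1 c \<Omega> (\<lambda>x. ereal (f x)) g \<noteq> {}"
  shows "cH_convex_on H V1 c \<Omega> (\<lambda>x. ereal (f x))"
  unfolding cH_convex_on_def
proof (intro conjI ballI)
  show "proper_on \<Omega> (\<lambda>x. ereal (f x))"
    using \<open>\<Omega> \<noteq> {}\<close> unfolding proper_on_def by auto
next
  fix g assume g: "g \<in> \<Omega>"
  let ?S = "cH_supports H V1 c \<Omega> (\<lambda>x. ereal (f x)) g"
  obtain p where "p \<in> V1" and "\<forall>g'\<in>H g \<inter> \<Omega>. f g' \<ge> f g + (c g' p - c g p)"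
    using sub[OF g] unfolding cH_subdifferential_def by auto
  then have mem: "(p, f g - c g p) \<in> ?S"
    unfolding cH_supports_def by (auto simp: algebra_simps)
  then show "?S \<noteq> {}" by blast
  show "ereal (f g) = (SUP (v, \<alpha>)\<in>?S. ereal (c g v + \<alpha>))"
  proof (rule antisym)
    show "ereal (f g) \<le> (SUP (v, \<alpha>)\<in>?S. ereal (c g v + \<alpha>))"
      by (rule SUP_upper2[OF mem]) simp
    show "(SUP (v, \<alpha>)\<in>?S. ereal (c g v + \<alpha>)) \<le> ereal (f g)"
      using g refl by (intro SUP_least) (auto simp: cH_supports_def)
  qed
qed

theorem ex_cH_potential:
  assumes refl: "\<And>x. x \<in> H x" and sym: "\<forall>x y. y \<in> H x \<longrightarrow> x \<in> H y"
    and T: "\<And>g. T g \<subseteq> V1" and mono: "cH_cyclically_monotone_map H c T"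
    and g0: "g0 \<in> mv_dom T"
  defines "\<Omega> \<equiv> H_reachable H g0 (mv_dom T)"
  shows "\<exists>f :: 'g \<Rightarrow> real. cH_convex_on H V1 c \<Omega> (\<lambda>g. ereal (f g)) \<and>
    (\<forall>g\<in>\<Omega>. T g \<subseteq> cH_subdifferential H V1 c \<Omega> (\<lambda>g. ereal (f g)) g)"
proof -
  define f where "f x = Sup {s. chain_gain H c T g0 x s}" for x
  have sub: "T g \<subseteq> cH_subdifferential H V1 c \<Omega> (\<lambda>g. ereal (f g)) g" if g: "g \<in> \<Omega>" for g
  proof
    fix p assume p: "p \<in> T g"
    have "f g + (c g' p - c g p) \<le> f g'" if g': "g' \<in> H g \<inter> \<Omega>" for g'
    proof -
      have "s \<le> f g' - (c g' p - c g p)" if "chain_gain H c T g0 g s" for s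
      proof -
        have "s + (c g' p - c g p) \<le> f g'"
          unfolding f_def
        proof (rule cSup_upper)
          show "s + (c g' p - c g p) \<in> {s. chain_gain H c T g0 g' s}"
            using chain_gain.step[OF that p] g' by blast
          show "bdd_above {s. chain_gain H c T g0 g' s}"
            using g' unfolding \<Omega>_def by (intro bdd_above_chain_gain[OF _ mono sym]) blast
        qed
        then show ?thesis by simp
      qed
      moreover have "\<exists>s. chain_gain H c T g0 g s"
        using g unfolding \<Omega>_def by (rule ex_chain_gain[OF _ refl g0])
      ultimately have "f g \<le> f g' - (c g' p - c g p)"
        unfolding f_def[of g] by (intro cSup_least) blast+
      then show ?thesis by simp
    qed
    then show "p \<in> cH_subdifferential H V1 c \<Omega> (\<lambda>g. ereal (f g)) g"
      using p T unfolding cH_subdifferential_def by auto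
  qed
  \<comment> \<open>Sequences witnessing reachability have at least one step, so \<open>g0\<close> is reached by standing
    still.\<close>
  have "g0 \<in> \<Omega>"
    unfolding \<Omega>_def H_reachable_def H_sequence_def mem_Collect_eq
    by (intro exI[of _ 1] exI[of _ "\<lambda>_. g0"]) (simp add: refl g0)
  moreover have "T g \<noteq> {}" if "g \<in> \<Omega>" for g
    using that H_reachable_subset[of H g0 "mv_dom T"] unfolding \<Omega>_def mv_dom_def by blast
  ultimately have "cH_convex_on H V1 c \<Omega> (\<lambda>g. ereal (f g))"
    using sub by (intro cH_convex_on_if_subdifferentiable[OF refl]) blast+
  with sub show ?thesis by blast
qed

section \<open>Horizontal planes\<close>

lemma one_parameter_subgroup_zero:
  assumes "group G" and "carrier G = UNIV" and "one_parameter_subgroup G A X \<gamma>"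
  shows "\<gamma> 0 = \<one>\<^bsub>G\<^esub>"
proof -
  interpret group G by fact
  have "\<gamma> (0 + 0) = \<gamma> 0 \<otimes>\<^bsub>G\<^esub> \<gamma> 0"
    using assms(3) unfolding one_parameter_subgroup_def by blast
  then show ?thesis
    using r_cancel_one[of "\<gamma> 0" "\<gamma> 0"] assms(2) by simp
qed

lemma has_exp_zero:
  assumes "group G"
  shows "has_exp G A 0 \<one>\<^bsub>G\<^esub>"
proof -
  interpret group G by fact
  have "one_parameter_subgroup G A 0 (\<lambda>_. \<one>\<^bsub>G\<^esub>)"
    unfolding one_parameter_subgroup_def by simp
  then show ?thesis unfolding has_exp_def by blast
qed

text \<open>Running the one-parameter subgroup of \<open>X\<close> backwards gives that of \<open>-X\<close>.\<close>

lemma has_exp_uminus: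
  assumes "group G" and "carrier G = UNIV" and "has_exp G A X h"
  shows "has_exp G A (- X) (inv\<^bsub>G\<^esub> h)"
proof -
  interpret group G by fact
  obtain \<gamma> where \<gamma>: "one_parameter_subgroup G A X \<gamma>" and h: "h = \<gamma> 1"
    using assms(3) unfolding has_exp_def by blast
  have add: "\<gamma> (s + t) = \<gamma> s \<otimes>\<^bsub>G\<^esub> \<gamma> t" for s t
    using \<gamma> unfolding one_parameter_subgroup_def by blast
  have "one_parameter_subgroup G A (- X) (\<lambda>t. \<gamma> (- t))"
    unfolding one_parameter_subgroup_def
  proof (intro conjI allI ballI)
    show "continuous_on UNIV (\<lambda>t. \<gamma> (- t))"
      using \<gamma> unfolding one_parameter_subgroup_def
      by (auto intro!: continuous_on_compose2[of UNIV \<gamma>] continuous_intros)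
    show "\<gamma> (- (s + t)) = \<gamma> (- s) \<otimes>\<^bsub>G\<^esub> \<gamma> (- t)" for s t
      using add[of "- s" "- t"] by simp
    fix f t assume "f \<in> smooth_functions A"
    then have "((\<lambda>s. f (\<gamma> s)) has_real_derivative X f (\<gamma> (- t))) (at (- t))"
      using \<gamma> unfolding one_parameter_subgroup_def by blast
    then have "((\<lambda>s. f (\<gamma> (- s))) has_real_derivative X f (\<gamma> (- t)) * (- 1)) (at t)"
      by (rule DERIV_chain2) (auto intro!: derivative_eq_intros)
    then show "((\<lambda>s. f (\<gamma> (- s))) has_real_derivative (- X) f (\<gamma> (- t))) (at t)"
      by simp
  qed
  moreover have "inv\<^bsub>G\<^esub> h = \<gamma> (- 1)"
    using add[of "- 1" 1] one_parameter_subgroup_zero[OF assms(1,2) \<gamma>] assms(2) h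
    by (intro inv_equality) auto
  ultimately show ?thesis unfolding has_exp_def by blast
qed

lemma horizontal_plane_refl:
  assumes "group G" and "carrier G = UNIV" and "subspace V1"
  shows "g \<in> horizontal_plane G A V1 g"
proof -
  interpret group G by fact
  have "\<one>\<^bsub>G\<^esub> \<in> exp_image G A V1"
    using has_exp_zero[OF assms(1)] subspace_0[OF assms(3)] unfolding exp_image_def by blast
  moreover have "g = g \<otimes>\<^bsub>G\<^esub> \<one>\<^bsub>G\<^esub>"
    using assms(2) by simp
  ultimately show ?thesis
    unfolding horizontal_plane_def by blast
qed

lemma horizontal_plane_sym:
  assumes "group G" and "carrier G = UNIV" and "subspace V1"
    and "y \<in> horizontal_plane G A V1 x"
  shows "x \<in> horizontal_plane G A V1 y"
proof -
  interpret group G by fact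
  obtain h where h: "h \<in> exp_image G A V1" and y: "y = x \<otimes>\<^bsub>G\<^esub> h"
    using assms(4) unfolding horizontal_plane_def by blast
  have "inv\<^bsub>G\<^esub> h \<in> exp_image G A V1"
    using h has_exp_uminus[OF assms(1,2)] subspace_neg[OF assms(3)]
    unfolding exp_image_def by blast
  moreover have "x = y \<otimes>\<^bsub>G\<^esub> inv\<^bsub>G\<^esub> h"
    using assms(2) y by (simp add: m_assoc)
  ultimately show ?thesis
    unfolding horizontal_plane_def by blast
qed

theorem theorem6p2:
  fixes G :: "('g::{t2_space,second_countable_topology}) monoid"
    and A :: "('g, 'e::euclidean_space) chart set"
    and r :: nat
    and V :: "nat \<Rightarrow> 'g vfield set"
    and c :: "'g \<Rightarrow> 'g vfield \<Rightarrow> real"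
    and T :: "'g \<Rightarrow> 'g vfield set"
    and g0 :: 'g
  assumes "carnot_group G A r V"
    and "\<forall>g. T g \<subseteq> V 1"
    and "cH_cyclically_monotone_map (horizontal_plane G A (V 1)) c T"
    and "g0 \<in> interior (mv_dom T)"
  shows "\<exists>f :: 'g \<Rightarrow> real.
    cH_convex_on (horizontal_plane G A (V 1)) (V 1) c
      (H_reachable (horizontal_plane G A (V 1)) g0 (mv_dom T)) (\<lambda>g. ereal (f g)) \<and>
    (\<forall>g\<in>H_reachable (horizontal_plane G A (V 1)) g0 (mv_dom T).
      T g \<subseteq> cH_subdifferential (horizontal_plane G A (V 1)) (V 1) c
        (H_reachable (horizontal_plane G A (V 1)) g0 (mv_dom T)) (\<lambda>g. ereal (f g)) g)"
proof -
  have G: "group G" "carrier G = UNIV"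
    using assms(1) unfolding carnot_group_def lie_group_def by simp_all
  have V1: "subspace (V 1)"
    using assms(1) unfolding carnot_group_def internal_direct_sum_def by simp
  have g0: "g0 \<in> mv_dom T"
    using assms(4) interior_subset by blast
  have sym: "\<forall>x y. y \<in> horizontal_plane G A (V 1) x \<longrightarrow> x \<in> horizontal_plane G A (V 1) y"
    using horizontal_plane_sym[OF G V1] by blast
  show ?thesis
    by (rule ex_cH_potential[OF horizontal_plane_refl[OF G V1] sym _ assms(3) g0])
      (rule assms(2)[rule_format])
qed

end
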